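(* Let $\alpha,r$ be complex numbers. For every real $s\geq 0$ and every integer $n\ge0$, $$\beta_{n+1}(\alpha,r)-\beta_{n+1}(\alpha,r-s)=(n+1)\sum_{k=0}^{n}S_{2}(n,k,r\mid\alpha)\frac{(-1)^{k}\langle s\rangle_{k+1}}{k+1}.$$
   Context: All generating functions are formal power series in $t$; $(1+\alpha t)^{c/\alpha}=\exp\left(\frac{c}{\alpha}\log(1+\alpha t)\right)$, interpreted as $e^{ct}$ when $\alpha=0$. Carlitz's degenerate Bernoulli polynomials $\beta_n(\alpha,x)$ are defined by $$\sum_{n=0}^{\infty}\beta_{n}(\alpha,x)\frac{t^{n}}{n!}=\frac{t}{(1+\alpha t)^{1/\alpha}-1}(1+\alpha t)^{x/\alpha}.$$ Howard's degenerate weighted Stirling numbers of the second kind $S_2(n,k,r\mid\alpha)$ are defined by $$\left((1+\alpha t)^{1/\alpha}-1\right)^{k}(1+\alpha t)^{r/\alpha}=k!\sum_{n=0}^{\infty}S_{2}(n,k,r\mid\alpha)\frac{t^{n}}{n!}.$$ The rising factorial is $\langle y\rangle_{0}=1$, $\langle y\rangle_{k}=y(y+1)\cdots(y+k-1)$. *)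

theory Defs
  imports "HOL-Computational_Algebra.Formal_Power_Series" Complex_Main
begin

text \<open>
  The formal power series \<open>(1 + \<alpha> t)^(c / \<alpha>)\<close> in \<open>t\<close>.
  Here \<open>fps_ln 1\<close> is the series of \<open>log (1 + t)\<close>, and
  \<open>fps_exp c\<close> that of \<open>e^(c t)\<close>.
\<close>

definition degenerate_exp :: "complex \<Rightarrow> complex \<Rightarrow> complex fps" where
  "degenerate_exp \<alpha> c =
     (if \<alpha> = 0 then fps_exp c
      else fps_exp 1 oo (fps_const (c / \<alpha>) * (fps_ln 1 oo (fps_const \<alpha> * fps_X))))"

text \<open>
  The denominator has order 1 in \<open>t\<close> (lemma \<open>degenerate_exp_minus_one_nth\<close>), so the quotient
  is the ordinary formal power series quotient (lemma \<open>carlitz_beta_egf\<close>).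
\<close>

definition carlitz_beta :: "nat \<Rightarrow> complex \<Rightarrow> complex \<Rightarrow> complex" where
  "carlitz_beta n \<alpha> x =
     fact n * fps_nth (fps_X / (degenerate_exp \<alpha> 1 - 1) * degenerate_exp \<alpha> x) n"

definition howard_S2 :: "nat \<Rightarrow> nat \<Rightarrow> complex \<Rightarrow> complex \<Rightarrow> complex" where
  "howard_S2 n k r \<alpha> =
     fact n / fact k * fps_nth ((degenerate_exp \<alpha> 1 - 1) ^ k * degenerate_exp \<alpha> r) n"

lemma degenerate_exp_nth_0: "fps_nth (degenerate_exp \<alpha> c) 0 = 1"
  by (simp add: degenerate_exp_def fps_compose_nth_0)

lemma degenerate_exp_nth_1: "fps_nth (degenerate_exp \<alpha> c) (Suc 0) = c"
  by (auto simp: degenerate_exp_def fps_compose_nth fps_mult_nth fps_ln_def)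

lemma degenerate_exp_minus_one_nth:
  "fps_nth (degenerate_exp \<alpha> 1 - 1) 0 = 0"
  "fps_nth (degenerate_exp \<alpha> 1 - 1) (Suc 0) = 1"
  by (simp_all add: degenerate_exp_nth_0 degenerate_exp_nth_1)

lemma carlitz_beta_egf:
  "(degenerate_exp \<alpha> 1 - 1) * Abs_fps (\<lambda>n. carlitz_beta n \<alpha> x / fact n)
     = fps_X * degenerate_exp \<alpha> x"
proof -
  let ?D = "degenerate_exp \<alpha> 1 - 1"
  have nz: "?D \<noteq> 0"
    using degenerate_exp_minus_one_nth(2)[of \<alpha>] by (metis fps_zero_nth zero_neq_one)
  have sub: "subdegree ?D = 1"
    by (rule subdegreeI) (simp_all add: degenerate_exp_nth_0 degenerate_exp_nth_1)
  have dvd: "?D dvd fps_X"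
    using nz sub by (simp add: fps_dvd_iff)
  have "Abs_fps (\<lambda>n. carlitz_beta n \<alpha> x / fact n) = fps_X / ?D * degenerate_exp \<alpha> x"
    by (simp add: fps_eq_iff carlitz_beta_def)
  then show ?thesis
    using dvd_mult_div_cancel[OF dvd] by (metis mult.assoc)
qed

lemma howard_S2_egf:
  "(degenerate_exp \<alpha> 1 - 1) ^ k * degenerate_exp \<alpha> r
     = fps_const (fact k) * Abs_fps (\<lambda>n. howard_S2 n k r \<alpha> / fact n)"
  by (simp add: fps_eq_iff howard_S2_def)

end

theory Submission
  imports Defs
begin

unbundle fps_syntax

text \<open>
  Every \<open>degenerate_exp \<alpha> c\<close> has the form \<open>e^(c L)\<close>, with \<open>L = log (1 + \<alpha> t) / \<alpha>\<close>
  (and \<open>L = t\<close> when \<open>\<alpha> = 0\<close>). So with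
  \<open>u = degenerate_exp \<alpha> 1 - 1\<close> it equals the binomial series \<open>(1 + u)^c\<close>. The left-hand side
  is then read off from \<open>t / u * (1 - (1 + u)^(-s)) * (1 + u)^r\<close>, where expanding
  \<open>(1 - (1 + u)^(-s)) / u\<close> in powers of \<open>u\<close> produces the generating functions of the
  Stirling numbers.
\<close>

text \<open>Both sides solve \<open>f' = c f\<close> with constant term 1. Substituting
  \<open>e^t - 1\<close> into \<open>(1 + X) B' = c B\<close> turns \<open>1 + X\<close> into
  \<open>e^t\<close>, which is exactly the inner derivative supplied by the chain rule.\<close>

lemma fps_binomial_compose_exp_minus_one:
  fixes c :: "'a :: field_char_0"
  shows "fps_binomial c oo (fps_exp 1 - 1) = fps_exp c"
proof -
  let ?E = "fps_exp 1 :: 'a fps" and ?B = "fps_binomial c"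
  let ?f = "?B oo (?E - 1)"
  have E0: "(?E - 1) $ 0 = 0" by simp
  have unit: "(1 + fps_X :: 'a fps) $ 0 \<noteq> 0" by simp
  have "(1 + fps_X) * fps_deriv ?B = (inverse (1 + fps_X) * (1 + fps_X)) * (fps_const c * ?B)"
    by (simp only: fps_binomial_deriv fps_divide_unit[OF unit] mult_ac)
  then have "(1 + fps_X) * fps_deriv ?B = fps_const c * ?B"
    by (simp only: inverse_mult_eq_1[OF unit] mult_1_left)
  then have "((1 + fps_X) * fps_deriv ?B) oo (?E - 1) = (fps_const c * ?B) oo (?E - 1)"
    by simp
  then have "?E * (fps_deriv ?B oo (?E - 1)) = fps_const c * ?f"
    by (simp add: fps_compose_mult_distrib[OF E0] fps_compose_add_distrib)
  then have "fps_deriv ?f = fps_const c * ?f"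
    by (simp add: fps_compose_deriv mult.commute)
  then have "?f = fps_const (?f $ 0) * fps_exp c"
    by (simp only: fps_exp_unique_ODE)
  then show ?thesis
    by (simp add: fps_compose_nth_0)
qed

text \<open>Confines the case split on \<open>\<alpha>\<close>: a single \<open>L\<close>,
  independent of \<open>c\<close>, lets identities between exponentials carry over by
  composition.\<close>

lemma degenerate_exp_eq_exp_compose:
  obtains L where "L $ 0 = 0" "\<And>c. degenerate_exp \<alpha> c = fps_exp c oo L"
proof (cases "\<alpha> = 0")
  case True
  then show ?thesis
    by (intro that[of fps_X]) (auto simp: degenerate_exp_def)
next
  case False
  define M where "M = fps_ln 1 oo (fps_const \<alpha> * fps_X)"
  define L where "L = fps_const (1 / \<alpha>) * M"
  have L0: "L $ 0 = 0"
    by (simp add: L_def M_def fps_compose_nth_0 fps_ln_def)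
  have "degenerate_exp \<alpha> c = fps_exp c oo L" for c
  proof -
    have "fps_exp c = fps_exp 1 oo (fps_const c * fps_X)"
      by simp
    then have "fps_exp c oo L = fps_exp 1 oo ((fps_const c * fps_X) oo L)"
      by (simp only:) (rule fps_compose_assoc[symmetric], simp_all add: L0)
    also have "(fps_const c * fps_X) oo L = fps_const (c / \<alpha>) * M"
      using L0 by (simp add: fps_compose_mult_distrib L_def flip: mult.assoc)
    finally show ?thesis
      using False by (simp add: degenerate_exp_def M_def)
  qed
  with L0 show ?thesis by (rule that)
qed

lemma degenerate_exp_add:
  "degenerate_exp \<alpha> (a + b) = degenerate_exp \<alpha> a * degenerate_exp \<alpha> b"
  by (rule degenerate_exp_eq_exp_compose[of \<alpha>])
     (simp add: fps_exp_add_mult fps_compose_mult_distrib)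

text \<open>Substituting \<open>L\<close> into the binomial identity for \<open>e^t - 1\<close>
  eliminates \<open>L\<close> and leaves a series in \<open>degenerate_exp \<alpha> 1 - 1\<close>
  alone.\<close>

lemma degenerate_exp_eq_binomial_compose:
  "degenerate_exp \<alpha> c = fps_binomial c oo (degenerate_exp \<alpha> 1 - 1)"
proof -
  obtain L where L0: "L $ 0 = 0" and L: "\<And>c. degenerate_exp \<alpha> c = fps_exp c oo L"
    using degenerate_exp_eq_exp_compose[of \<alpha>] by blast
  have "fps_exp c oo L = (fps_binomial c oo (fps_exp 1 - 1)) oo L"
    by (simp only: fps_binomial_compose_exp_minus_one)
  also have "\<dots> = fps_binomial c oo ((fps_exp 1 - 1) oo L)"
    by (rule fps_compose_assoc[symmetric]) (simp_all add: L0)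
  also have "(fps_exp 1 - 1) oo L = degenerate_exp \<alpha> 1 - 1"
    by (simp add: L fps_compose_sub_distrib)
  finally show ?thesis by (simp only: L)
qed

lemma fps_mult_compose_nth:
  fixes a g u :: "'a :: comm_ring_1 fps"
  assumes "u $ 0 = 0"
  shows "(a * (g oo u)) $ n = (\<Sum>k=0..n. g $ k * (u ^ k * a) $ n)"
proof -
  \<comment> \<open>As \<open>u\<close> has no constant term, \<open>u ^ k\<close> vanishes below
    degree \<open>k\<close>. The bound \<open>m\<close> can thus be raised to \<open>n\<close>, the
    same for all \<open>m\<close>, which allows the sums to be swapped.\<close>
  have "(g oo u) $ m = (\<Sum>k=0..n. g $ k * u ^ k $ m)" if "m \<le> n" for m
    unfolding fps_compose_nth using that assms
    by (intro sum.mono_neutral_left) (auto simp: startsby_zero_power_prefix)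
  then have "((g oo u) * a) $ n = (\<Sum>i=0..n. (\<Sum>k=0..n. g $ k * u ^ k $ i) * a $ (n - i))"
    by (simp add: fps_mult_nth)
  also have "\<dots> = (\<Sum>k=0..n. g $ k * (u ^ k * a) $ n)"
    by (simp add: fps_mult_nth sum_distrib_left sum_distrib_right mult.assoc) (rule sum.swap)
  finally show ?thesis by (simp only: mult.commute)
qed

text \<open>The constant terms cancel, so \<open>fps_X\<close> factors out; the rest is
  \<open>(-s choose k) = (-1)^k * pochhammer s k / k!\<close> with the index shifted by one.\<close>

lemma one_minus_fps_binomial_uminus:
  fixes s :: "'a :: field_char_0"
  shows "1 - fps_binomial (- s)
    = fps_X * Abs_fps (\<lambda>k. (-1) ^ k * pochhammer s (k + 1) / fact (k + 1))"
proof (rule fps_ext)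
  fix n
  show "(1 - fps_binomial (- s)) $ n
    = (fps_X * Abs_fps (\<lambda>k. (-1) ^ k * pochhammer s (k + 1) / fact (k + 1))) $ n"
    by (cases n) (simp_all add: gbinomial_pochhammer)
qed

theorem theorem4:
  fixes \<alpha> r :: complex and s :: real and n :: nat
  assumes "s \<ge> 0"
  shows "carlitz_beta (n + 1) \<alpha> r - carlitz_beta (n + 1) \<alpha> (r - of_real s)
       = of_nat (n + 1) *
         (\<Sum>k=0..n. howard_S2 n k r \<alpha> * ((-1) ^ k * pochhammer (of_real s) (k + 1) / of_nat (k + 1)))"
proof -
  define s' where "s' = complex_of_real s"
  define u where "u = degenerate_exp \<alpha> 1 - 1"
  \<comment> \<open>\<open>G\<close> is \<open>(1 - (1 + X)^(-s)) / X\<close>, written without a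
    quotient.\<close>
  define G where "G = Abs_fps (\<lambda>k. (-1) ^ k * pochhammer s' (k + 1) / fact (k + 1))"
  have u0: "u $ 0 = 0" and u1: "u $ Suc 0 = 1"
    unfolding u_def by (rule degenerate_exp_minus_one_nth)+
  have "u \<noteq> 0" using u1 by auto
  moreover have "subdegree u = 1"
    by (rule subdegreeI) (simp_all add: u0 u1)
  \<comment> \<open>The division is exact because \<open>u\<close> has order 1.\<close>
  ultimately have cancel: "fps_X / u * u = fps_X"
    by (simp add: fps_dvd_iff)
  have "1 - degenerate_exp \<alpha> (- s') = (1 - fps_binomial (- s')) oo u"
    by (simp add: degenerate_exp_eq_binomial_compose[of \<alpha> "- s'"] fps_compose_sub_distrib u_def)
  also have "\<dots> = u * (G oo u)"
    unfolding one_minus_fps_binomial_uminus G_def[symmetric]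
    by (simp add: fps_compose_mult_distrib u0)
  finally have one_minus: "1 - degenerate_exp \<alpha> (- s') = u * (G oo u)" .
  have "degenerate_exp \<alpha> r - degenerate_exp \<alpha> (r - s')
      = degenerate_exp \<alpha> r * (1 - degenerate_exp \<alpha> (- s'))"
    using degenerate_exp_add[of \<alpha> r "- s'"] by (simp add: right_diff_distrib)
  also have "\<dots> = u * (degenerate_exp \<alpha> r * (G oo u))"
    by (simp only: one_minus mult.left_commute)
  finally have diff: "degenerate_exp \<alpha> r - degenerate_exp \<alpha> (r - s')
      = u * (degenerate_exp \<alpha> r * (G oo u))" .
  have "carlitz_beta (n + 1) \<alpha> r - carlitz_beta (n + 1) \<alpha> (r - s')
      = fact (n + 1) * (fps_X / u * (degenerate_exp \<alpha> r - degenerate_exp \<alpha> (r - s'))) $ (n + 1)"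
    by (simp only: carlitz_beta_def u_def right_diff_distrib fps_sub_nth)
  \<comment> \<open>The factor \<open>u\<close> of the difference cancels the denominator; the
    remaining \<open>fps_X\<close> lowers the coefficient index from \<open>n + 1\<close> to
    \<open>n\<close>.\<close>
  also have "fps_X / u * (degenerate_exp \<alpha> r - degenerate_exp \<alpha> (r - s'))
      = fps_X * (degenerate_exp \<alpha> r * (G oo u))"
    by (simp only: diff cancel flip: mult.assoc)
  also have "fact (n + 1) * (fps_X * (degenerate_exp \<alpha> r * (G oo u))) $ (n + 1)
      = fact (n + 1) * (\<Sum>k=0..n. G $ k * (u ^ k * degenerate_exp \<alpha> r) $ n)"
    by (simp add: fps_mult_compose_nth[OF u0])
  also have "\<dots> = of_nat (n + 1) *
      (\<Sum>k=0..n. howard_S2 n k r \<alpha> * ((-1) ^ k * pochhammer s' (k + 1) / of_nat (k + 1)))"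
    unfolding sum_distrib_left
  proof (rule sum.cong[OF refl])
    fix k
    \<comment> \<open>The factors \<open>fact n\<close> and \<open>1 / fact k\<close> go into
      \<open>howard_S2\<close>, leaving \<open>n + 1\<close> in front and \<open>k + 1\<close> in
      the denominator.\<close>
    have "fact (k + 1) = (of_nat (k + 1) * fact k :: complex)"
         "fact (n + 1) = (of_nat (n + 1) * fact n :: complex)"
      by simp_all
    then show "fact (n + 1) * (G $ k * (u ^ k * degenerate_exp \<alpha> r) $ n)
      = of_nat (n + 1) *
        (howard_S2 n k r \<alpha> * ((-1) ^ k * pochhammer s' (k + 1) / of_nat (k + 1)))"
      unfolding G_def howard_S2_def u_def fps_nth_Abs_fps
      by (simp only: times_divide_eq_left times_divide_eq_right divide_divide_eq_left mult_ac)
  qed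
  finally show ?thesis unfolding s'_def .
qed

end
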